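(* A rooted tree is primitive for $\Delta^*$ if, and only if, each of its vertices except the leaves has fertility at least two.
   Context: $\mathbb{K}$ is a field and $\Omega$ is a finite set (more generally, one may assume that each space of forests with $n$ vertices is itself graded with finite-dimensional components). Rooted forests are finite, non-planar (up to isomorphism), with vertices decorated by $\Omega$; a rooted tree is a connected rooted forest. $\mathcal{F}_\Omega$ is the $\mathbb{K}$-vector space freely generated by rooted forests, including the empty forest $\emptyset$. Concatenation (disjoint union) of forests is written by juxtaposition. $B_+^a$ ($a\in\Omega$) sends a forest $T_1\cdots T_k$ to the tree obtained by adding a new root decorated by $a$ linked to the root of each $T_i$. The fertility of a vertex is its number of direct descendants. The shuffle product $\mathbin{\sqcup\!\sqcup}^T$ is the bilinear product on $\mathcal{F}_\Omega$ defined recursively by: $F\mathbin{\sqcup\!\sqcup}^T\emptyset=\emptyset\mathbin{\sqcup\!\sqcup}^T F=F$; if $F=T_1\cdots T_k$, $F'=t_1\cdots t_n$ with non-empty trees, $k,n\ge1$ and $k+n\ge3$, $F\mathbin{\sqcup\!\sqcup}^T F'=\frac1{kn}\sum_{i=1}^k\sum_{j=1}^n(T_i\mathbin{\sqcup\!\sqcup}^T t_j)T_1\cdots\widehat{T_i}\cdots T_k t_1\cdots\widehat{t_j}\cdots t_n$ (hats denote omission); and for non-empty trees $T=B_+^a(f)$, $T'=B_+^{a'}(f')$, $T\mathbin{\sqcup\!\sqcup}^T T'=B_+^a(f\mathbin{\sqcup\!\sqcup}^T T')+B_+^{a'}(T\mathbin{\sqcup\!\sqcup}^T f')$. $\mathcal{F}_\Omega^\circ$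 is the graded dual of $\mathcal{F}_\Omega$ (graded by number of vertices). A forest $F$ viewed in $\mathcal{F}_\Omega^\circ$ denotes the dual basis element: $\langle F,F'\rangle=1$ if $F=F'$ and $0$ otherwise. The dual coproduct is defined by $\langle\Delta^*(F),a\otimes b\rangle=\langle F,a\mathbin{\sqcup\!\sqcup}^T b\rangle$. A tree $T$ is primitive for $\Delta^*$ if $\Delta^*(T)=T\otimes\emptyset+\emptyset\otimes T$.
   Formalization: The field K is taken of characteristic zero, since the factor 1/(kn) in the definition of the shuffle product is undefined when the characteristic of K divides kn. *)

theory Defs
  imports Complex_Main "HOL-Library.Multiset" "HOL-Library.Poly_Mapping"
begin

(* A non-planar rooted forest is a finite multiset of rooted trees, so equality of terms is
   isomorphism of decorated rooted forests, the empty forest is {#}, and disjoint union is +. *)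

datatype 'o rtree = Node 'o "'o rtree multiset"

type_synonym 'o forest = "'o rtree multiset"

(* A vertex of a tree is represented by the subtree of all its descendants.  Distinct vertices
   may carry isomorphic subtrees, hence a multiset. *)

primrec vertices :: "'o rtree \<Rightarrow> 'o rtree multiset" where
  "vertices (Node a F) = add_mset (Node a F) (\<Sum>\<^sub># (image_mset vertices F))"

primrec fertility :: "'o rtree \<Rightarrow> nat" where
  "fertility (Node a F) = size F"

definition is_leaf :: "'o rtree \<Rightarrow> bool" where
  "is_leaf v \<longleftrightarrow> fertility v = 0"

definition nvert :: "'o forest \<Rightarrow> nat" where
  "nvert F = size (\<Sum>\<^sub># (image_mset vertices F))"

lemma nvert_simps [simp]:
  "nvert {#} = 0"
  "nvert (add_mset T F) = size (vertices T) + nvert F"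
  "nvert (F + G) = nvert F + nvert G"
  "size (vertices (Node a F)) = Suc (nvert F)"
  by (simp_all add: nvert_def)

lemma nvert_diff: "T \<in># F \<Longrightarrow> size (vertices T) + nvert (F - {#T#}) = nvert F"
  by (metis insert_DiffM nvert_simps(2))

lemma nvert_member: "T \<in># F \<Longrightarrow> size (vertices T) \<le> nvert F"
  by (metis nvert_diff le_add1)

(* The space freely generated by rooted forests.  Multiset union makes the forests a commutative
   monoid, and the product * of Poly_Mapping is the resulting monoid algebra product, i.e. the
   bilinear extension of concatenation of forests.  Scalars have characteristic zero: the shuffle
   product divides by arbitrary positive integers. *)

type_synonym ('o, 'k) fspace = "'o forest \<Rightarrow>\<^sub>0 'k"

abbreviation basis :: "'b \<Rightarrow> 'b \<Rightarrow>\<^sub>0 'k::field_char_0" where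
  "basis b \<equiv> Poly_Mapping.single b 1"

abbreviation smul :: "'k \<Rightarrow> ('b \<Rightarrow>\<^sub>0 'k) \<Rightarrow> ('b \<Rightarrow>\<^sub>0 'k::field_char_0)" (infixr "\<cdot>" 75) where
  "c \<cdot> x \<equiv> Poly_Mapping.map ((*) c) x"

definition Bplus :: "'o \<Rightarrow> ('o, 'k::field_char_0) fspace \<Rightarrow> ('o, 'k) fspace" where
  "Bplus a x = (\<Sum>F\<in>Poly_Mapping.keys x. Poly_Mapping.lookup x F \<cdot> basis {#Node a F#})"

(* The shuffle product of two basis elements, first for two trees, then for two forests.  For
   one-tree forests the last formula of sh_forest reduces to sh_tree, see shuffle_tree below. *)

declare image_mset_cong [fundef_cong]

function
  sh_tree :: "'o rtree \<Rightarrow> 'o rtree \<Rightarrow> ('o, 'k::field_char_0) fspace" and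
  sh_forest :: "'o forest \<Rightarrow> 'o forest \<Rightarrow> ('o, 'k::field_char_0) fspace"
where
  "sh_tree (Node a f) (Node a' f') =
     Bplus a (sh_forest f {#Node a' f'#}) + Bplus a' (sh_forest {#Node a f#} f')"
| "sh_forest F F' =
     (if F = {#} then basis F'
      else if F' = {#} then basis F
      else (1 / of_nat (size F * size F')) \<cdot>
        (\<Sum>T\<in>#F. \<Sum>t\<in>#F'. sh_tree T t * basis ((F - {#T#}) + (F' - {#t#}))))"
  by pat_completeness auto
termination
  by (relation "measure (\<lambda>s. case s of
        Inl (T, t) \<Rightarrow> 2 * (size (vertices T) + size (vertices t))
      | Inr (F, F') \<Rightarrow> 2 * (nvert F + nvert F') + 1)")
     (auto dest!: nvert_member simp: less_Suc_eq_le simp del: vertices.simps intro!: add_mono)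

declare sh_tree.simps [simp del] sh_forest.simps [simp del]

definition shuffle ::
  "('o, 'k::field_char_0) fspace \<Rightarrow> ('o, 'k) fspace \<Rightarrow> ('o, 'k) fspace" where
  "shuffle x y = (\<Sum>F\<in>Poly_Mapping.keys x. \<Sum>G\<in>Poly_Mapping.keys y.
     (Poly_Mapping.lookup x F * Poly_Mapping.lookup y G) \<cdot> sh_forest F G)"

lemma smul_one [simp]: "(1::'k::field_char_0) \<cdot> x = x"
  by (rule poly_mapping_eqI) (simp add: map.rep_eq when_def)

lemma shuffle_basis: "shuffle (basis F) (basis G) = sh_forest F G"
  by (simp add: shuffle_def)

lemma shuffle_empty:
  "shuffle (basis F) (basis {#}) = basis F"
  "shuffle (basis {#}) (basis F) = basis F"
  unfolding shuffle_basis by (simp_all add: sh_forest.simps[of F "{#}"] sh_forest.simps[of "{#}" F])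

lemma shuffle_tree:
  "shuffle (basis {#Node a f#}) (basis {#Node a' f'#}) =
     Bplus a (shuffle (basis f) (basis {#Node a' f'#})) +
     Bplus a' (shuffle (basis {#Node a f#}) (basis f'))"
  unfolding shuffle_basis
  by (subst sh_forest.simps) (simp add: sh_tree.simps)

lemma shuffle_forest:
  assumes "F \<noteq> {#}" "F' \<noteq> {#}"
  shows "shuffle (basis F) (basis F') =
    (1 / of_nat (size F * size F')) \<cdot>
      (\<Sum>T\<in>#F. \<Sum>t\<in>#F'. shuffle (basis {#T#}) (basis {#t#})
         * basis ((F - {#T#}) + (F' - {#t#})))"
proof -
  have "sh_forest {#T#} {#t#} = (sh_tree T t :: ('a, 'b) fspace)" for T t
    by (subst sh_forest.simps) (simp)
  then show ?thesis
    using assms by (simp add: shuffle_basis sh_forest.simps[of F F'])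
qed

(* As there are finitely many forests with n vertices (finite_forests below), the graded dual of
   the space of forests has the dual basis of the forests as a basis; it is represented by its
   coordinates in this basis.  Likewise tensor squares have the pairs of basis elements as a
   basis. *)

type_synonym ('o, 'k) fdual = "'o forest \<Rightarrow>\<^sub>0 'k"

definition pairing :: "('b \<Rightarrow>\<^sub>0 'k) \<Rightarrow> ('b \<Rightarrow>\<^sub>0 'k) \<Rightarrow> 'k::field_char_0" where
  "pairing \<phi> x = (\<Sum>b\<in>Poly_Mapping.keys x. Poly_Mapping.lookup \<phi> b * Poly_Mapping.lookup x b)"

definition tensor ::
  "('b \<Rightarrow>\<^sub>0 'k) \<Rightarrow> ('c \<Rightarrow>\<^sub>0 'k) \<Rightarrow> ('b \<times> 'c \<Rightarrow>\<^sub>0 'k::field_char_0)" (infixr "\<otimes>" 70) where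
  "x \<otimes> y = (\<Sum>b\<in>Poly_Mapping.keys x. \<Sum>c\<in>Poly_Mapping.keys y.
     Poly_Mapping.single (b, c) (Poly_Mapping.lookup x b * Poly_Mapping.lookup y c))"

(* Existence and uniqueness of this element: dual_coproduct_ex1 below. *)

definition dual_coproduct ::
  "('o::finite, 'k::field_char_0) fdual \<Rightarrow> ('o forest \<times> 'o forest \<Rightarrow>\<^sub>0 'k)" where
  "dual_coproduct \<phi> = (THE D. \<forall>a b. pairing D (a \<otimes> b) = pairing \<phi> (shuffle a b))"

definition dual_primitive :: "('o::finite, 'k::field_char_0) fdual \<Rightarrow> bool" where
  "dual_primitive \<phi> \<longleftrightarrow> dual_coproduct \<phi> = \<phi> \<otimes> basis {#} + basis {#} \<otimes> \<phi>"

lemma pairing_basis: "pairing (basis F) (basis F') = (if F = F' then 1 else 0)"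
  by (simp add: pairing_def lookup_single when_def)

lemma lookup_tensor [simp]:
  "Poly_Mapping.lookup (x \<otimes> y) (b, c) = Poly_Mapping.lookup x b * Poly_Mapping.lookup y c"
proof -
  have "Poly_Mapping.lookup (x \<otimes> y) (b, c) = (\<Sum>(b', c')\<in>Poly_Mapping.keys x \<times> Poly_Mapping.keys y.
      if (b', c') = (b, c) then Poly_Mapping.lookup x b' * Poly_Mapping.lookup y c' else 0)"
    unfolding tensor_def by (simp add: lookup_sum lookup_single when_def flip: sum.cartesian_product)
  also have "\<dots> = (\<Sum>p\<in>Poly_Mapping.keys x \<times> Poly_Mapping.keys y.
      if p = (b, c) then Poly_Mapping.lookup x b * Poly_Mapping.lookup y c else 0)"
    by (rule sum.cong) (auto split: if_splits)
  also have "\<dots> = Poly_Mapping.lookup x b * Poly_Mapping.lookup y c"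
    by (auto simp: sum.delta in_keys_iff)
  finally show ?thesis .
qed

lemma pairing_superset:
  assumes "finite A" "Poly_Mapping.keys x \<subseteq> A"
  shows "pairing \<phi> x = (\<Sum>b\<in>A. Poly_Mapping.lookup \<phi> b * Poly_Mapping.lookup x b)"
  unfolding pairing_def using assms by (intro sum.mono_neutral_left) (auto simp: in_keys_iff)

lemma keys_tensor: "Poly_Mapping.keys (x \<otimes> y) \<subseteq> Poly_Mapping.keys x \<times> Poly_Mapping.keys y"
  by (auto simp: in_keys_iff)

lemma pairing_tensor: "pairing (\<phi> \<otimes> \<psi>) (x \<otimes> y) = pairing \<phi> x * pairing \<psi> y"
proof -
  have "pairing (\<phi> \<otimes> \<psi>) (x \<otimes> y) = (\<Sum>(b, c)\<in>Poly_Mapping.keys x \<times> Poly_Mapping.keys y.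
      (Poly_Mapping.lookup \<phi> b * Poly_Mapping.lookup x b) *
      (Poly_Mapping.lookup \<psi> c * Poly_Mapping.lookup y c))"
    by (subst pairing_superset[OF _ keys_tensor]) (auto intro!: sum.cong)
  then show ?thesis
    by (simp add: pairing_def sum_product sum.cartesian_product)
qed

lemma finite_forests: "finite {F :: 'o::finite forest. nvert F \<le> n}"
proof (induction n)
  case 0
  have "F = {#}" if "nvert F = 0" for F :: "'o forest"
    using that by (induction F) (auto, metis nvert_simps(4) rtree.exhaust vertices.simps add_is_0
      size_eq_0_iff_empty add_mset_not_empty)
  then have "{F :: 'o forest. nvert F \<le> 0} \<subseteq> {{#}}" by auto
  then show ?case using finite_subset by blast
next
  case (Suc n)
  define A where "A = (\<lambda>(a, f). Node a f) ` (UNIV \<times> {F :: 'o forest. nvert F \<le> n})"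
  have finA: "finite A" using Suc by (auto simp: A_def)
  have tA: "T \<in> A" if "size (vertices T) \<le> Suc n" for T
    using that by (cases T) (force simp: A_def simp del: vertices.simps)
  have szle: "size F \<le> nvert F" for F :: "'o forest"
  proof (induction F)
    case (add T F)
    then show ?case by (cases T) (simp del: vertices.simps)
  qed simp
  have "{F :: 'o forest. nvert F \<le> Suc n} \<subseteq> mset ` {xs. set xs \<subseteq> A \<and> length xs \<le> Suc n}"
  proof
    fix F :: "'o forest" assume "F \<in> {F. nvert F \<le> Suc n}"
    then have le: "nvert F \<le> Suc n" by simp
    obtain xs where xs: "mset xs = F" using ex_mset by blast
    have "set xs \<subseteq> A" using le tA nvert_member xs by (metis order_trans set_mset_mset subsetI)
    moreover have "length xs \<le> Suc n" using le szle xs by (metis order_trans size_mset)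
    ultimately show "F \<in> mset ` {xs. set xs \<subseteq> A \<and> length xs \<le> Suc n}" using xs by blast
  qed
  then show ?case using finite_lists_length_le[OF finA] finite_subset by blast
qed

lemma keys_smul: "Poly_Mapping.keys (c \<cdot> x) \<subseteq> Poly_Mapping.keys x"
  by (auto simp: in_keys_iff map.rep_eq when_def)

lemma keys_Bplus: "Poly_Mapping.keys (Bplus a x) \<subseteq> (\<lambda>F. {#Node a F#}) ` Poly_Mapping.keys x"
  unfolding Bplus_def by (rule order_trans[OF keys_sum]) (use keys_smul in fastforce)

lemma keys_sum_mset: "H \<in> Poly_Mapping.keys (\<Sum>T\<in>#F. h T :: 'b \<Rightarrow>\<^sub>0 'k::field_char_0) \<Longrightarrow>
  \<exists>T. T \<in># F \<and> H \<in> Poly_Mapping.keys (h T)"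
proof (induction F)
  case (add T F)
  then show ?case using keys_add[of "h T" "\<Sum>T\<in>#F. h T"] by auto
qed simp

lemma nvert_shuffle:
  "H \<in> Poly_Mapping.keys (sh_tree T t :: ('o, 'k::field_char_0) fspace) \<Longrightarrow>
     nvert H = size (vertices T) + size (vertices t)"
  "H \<in> Poly_Mapping.keys (sh_forest F G :: ('o, 'k) fspace) \<Longrightarrow> nvert H = nvert F + nvert G"
proof (induction T t and F G arbitrary: H and H rule: sh_tree_sh_forest.induct)
  case (1 a f a' f')
  from "1.prems" have "H \<in> Poly_Mapping.keys (Bplus a (sh_forest f {#Node a' f'#}) :: ('o, 'k) fspace)
      \<or> H \<in> Poly_Mapping.keys (Bplus a' (sh_forest {#Node a f#} f') :: ('o, 'k) fspace)"
    unfolding sh_tree.simps by (rule subsetD[OF keys_add, THEN UnE]) simp_all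
  then show ?case
  proof
    assume "H \<in> Poly_Mapping.keys (Bplus a (sh_forest f {#Node a' f'#}) :: ('o, 'k) fspace)"
    then obtain K where K: "K \<in> Poly_Mapping.keys (sh_forest f {#Node a' f'#} :: ('o, 'k) fspace)"
      and H: "H = {#Node a K#}"
      by (rule subsetD[OF keys_Bplus, THEN imageE])
    show ?thesis
      using "1.IH"(1)[OF K] by (simp add: H del: vertices.simps)
  next
    assume "H \<in> Poly_Mapping.keys (Bplus a' (sh_forest {#Node a f#} f') :: ('o, 'k) fspace)"
    then obtain K where K: "K \<in> Poly_Mapping.keys (sh_forest {#Node a f#} f' :: ('o, 'k) fspace)"
      and H: "H = {#Node a' K#}"
      by (rule subsetD[OF keys_Bplus, THEN imageE])
    show ?thesis
      using "1.IH"(2)[OF K] by (simp add: H del: vertices.simps)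
  qed
next
  case (2 F F')
  show ?case
  proof (cases "F = {#} \<or> F' = {#}")
    case True
    then show ?thesis using "2.prems" by (auto simp: sh_forest.simps[of F F'] split: if_splits)
  next
    case False
    then have "sh_forest F F' = (1 / of_nat (size F * size F')) \<cdot> (\<Sum>T\<in>#F. \<Sum>t\<in>#F'.
        sh_tree T t * basis ((F - {#T#}) + (F' - {#t#})) :: ('o, 'k) fspace)"
      by (simp only: sh_forest.simps[of F F'] de_Morgan_disj if_False)
    with "2.prems" have "H \<in> Poly_Mapping.keys (\<Sum>T\<in>#F. \<Sum>t\<in>#F'.
        sh_tree T t * basis ((F - {#T#}) + (F' - {#t#})) :: ('o, 'k) fspace)"
      by (simp only: subsetD[OF keys_smul])
    then obtain T t where Tt: "T \<in># F" "t \<in># F'" and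
      "H \<in> Poly_Mapping.keys (sh_tree T t * basis ((F - {#T#}) + (F' - {#t#})) :: ('o, 'k) fspace)"
      using keys_sum_mset by meson
    then obtain K L where K: "K \<in> Poly_Mapping.keys (sh_tree T t :: ('o, 'k) fspace)"
      and L: "L \<in> Poly_Mapping.keys (basis ((F - {#T#}) + (F' - {#t#})) :: ('o, 'k) fspace)"
      and HKL: "H = K + L"
      using subsetD[OF keys_mult] by (smt (verit) mem_Collect_eq)
    from L have "L = (F - {#T#}) + (F' - {#t#})"
      unfolding keys_single by simp
    with HKL have H: "H = K + ((F - {#T#}) + (F' - {#t#}))" by simp
    have "nvert K = size (vertices T) + size (vertices t)"
      using False Tt K by (intro "2.IH") auto
    then show ?thesis using H nvert_diff[OF Tt(1)] nvert_diff[OF Tt(2)] by simp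
  qed
qed

lemma pairing_shuffle:
  fixes x y :: "('o, 'k::field_char_0) fspace"
  shows "pairing \<phi> (shuffle x y) = (\<Sum>F\<in>Poly_Mapping.keys x. \<Sum>G\<in>Poly_Mapping.keys y.
     (Poly_Mapping.lookup x F * Poly_Mapping.lookup y G) * pairing \<phi> (sh_forest F G))"
proof -
  define A where "A = (\<Union>F\<in>Poly_Mapping.keys x. \<Union>G\<in>Poly_Mapping.keys y.
    Poly_Mapping.keys (sh_forest F G :: ('o, 'k) fspace))"
  have fin: "finite A" by (simp add: A_def)
  have sub: "Poly_Mapping.keys (shuffle x y) \<subseteq> A"
    unfolding shuffle_def A_def
    by (intro order_trans[OF keys_sum] UN_mono order_refl order_trans[OF keys_smul])
  have "pairing \<phi> (sh_forest F G) = (\<Sum>H\<in>A. Poly_Mapping.lookup \<phi> H * Poly_Mapping.lookup (sh_forest F G) H)"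
    if "F \<in> Poly_Mapping.keys x" "G \<in> Poly_Mapping.keys y" for F G
    using that by (intro pairing_superset fin) (auto simp: A_def)
  then have "(\<Sum>F\<in>Poly_Mapping.keys x. \<Sum>G\<in>Poly_Mapping.keys y.
     (Poly_Mapping.lookup x F * Poly_Mapping.lookup y G) * pairing \<phi> (sh_forest F G)) =
    (\<Sum>F\<in>Poly_Mapping.keys x. \<Sum>G\<in>Poly_Mapping.keys y. \<Sum>H\<in>A.
     (Poly_Mapping.lookup x F * Poly_Mapping.lookup y G) *
       (Poly_Mapping.lookup \<phi> H * Poly_Mapping.lookup (sh_forest F G) H))"
    by (simp add: sum_distrib_left)
  also have "\<dots> = (\<Sum>H\<in>A. \<Sum>F\<in>Poly_Mapping.keys x. \<Sum>G\<in>Poly_Mapping.keys y.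
     (Poly_Mapping.lookup x F * Poly_Mapping.lookup y G) *
       (Poly_Mapping.lookup \<phi> H * Poly_Mapping.lookup (sh_forest F G) H))"
    by (subst sum.swap[of _ _ A], subst sum.swap[of _ A]) (rule refl)
  also have "\<dots> = (\<Sum>H\<in>A. Poly_Mapping.lookup \<phi> H * Poly_Mapping.lookup (shuffle x y) H)"
    by (simp add: shuffle_def lookup_sum sum_distrib_left map.rep_eq when_def algebra_simps)
       (intro sum.cong refl, simp)
  also have "\<dots> = pairing \<phi> (shuffle x y)"
    by (simp add: pairing_superset[OF fin sub])
  finally show ?thesis by simp
qed

lemma dual_coproduct_ex1:
  fixes \<phi> :: "('o::finite, 'k::field_char_0) fdual"
  shows "\<exists>!D. \<forall>a b. pairing D (a \<otimes> b) = pairing \<phi> (shuffle a b)"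
proof -
  define d where "d = (\<lambda>(F, G). pairing \<phi> (sh_forest F G))"
  define N where "N = Max (insert 0 (nvert ` Poly_Mapping.keys \<phi>))"
  have N: "nvert H \<le> N" if "H \<in> Poly_Mapping.keys \<phi>" for H
    using that by (auto simp: N_def intro!: Max_ge)
  have "nvert F + nvert G \<le> N" if "d (F, G) \<noteq> 0" for F G
  proof -
    have "\<exists>H \<in> Poly_Mapping.keys (sh_forest F G :: ('o, 'k) fspace). Poly_Mapping.lookup \<phi> H \<noteq> 0"
      using that sum.not_neutral_contains_not_neutral by (force simp: d_def pairing_def)
    then show ?thesis using N nvert_shuffle(2) by (metis in_keys_iff)
  qed
  then have "{p. d p \<noteq> 0} \<subseteq> {F. nvert F \<le> N} \<times> {G. nvert G \<le> N}"
    by fastforce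
  then have fin: "finite {p. d p \<noteq> 0}"
    by (rule finite_subset) (simp add: finite_forests)
  have D: "Poly_Mapping.lookup (Abs_poly_mapping d) = d"
    using fin by simp
  have d: "d (F, G) = pairing \<phi> (sh_forest F G)" for F G
    by (simp add: d_def)
  have "pairing (Abs_poly_mapping d) (a \<otimes> b) = pairing \<phi> (shuffle a b)" for a b
    by (subst pairing_superset[OF _ keys_tensor])
       (auto simp: D d pairing_shuffle sum.cartesian_product intro!: sum.cong)
  moreover have "D' = Abs_poly_mapping d"
    if "\<forall>a b. pairing D' (a \<otimes> b) = pairing \<phi> (shuffle a b)" for D'
  proof (rule poly_mapping_eqI)
    fix p :: "'o forest \<times> 'o forest"
    obtain F G where p: "p = (F, G)" by (cases p)
    have "basis F \<otimes> basis G = (basis p :: 'o forest \<times> 'o forest \<Rightarrow>\<^sub>0 'k)"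
      by (simp add: tensor_def p)
    then have "Poly_Mapping.lookup D' p = pairing D' (basis F \<otimes> basis G)"
      by (simp add: pairing_def)
    also have "\<dots> = d p"
      using that by (simp add: shuffle_basis d_def p)
    finally show "Poly_Mapping.lookup D' p = Poly_Mapping.lookup (Abs_poly_mapping d) p"
      by (simp add: D)
  qed
  ultimately show ?thesis by blast
qed

lemma dual_coproduct: "pairing (dual_coproduct \<phi>) (a \<otimes> b) = pairing \<phi> (shuffle a b)"
  using theI'[OF dual_coproduct_ex1[of \<phi>]] by (simp add: dual_coproduct_def)

end

theory Submission
  imports Defs
begin

text \<open>
  The coordinate of the dual coproduct of \<open>\<phi>\<close> at a pair of forests is the pairing of \<open>\<phi>\<close> with
  their shuffle, so a tree is primitive exactly if it has coefficient zero in the shuffle of any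
  two non-empty forests (\<open>dual_primitive_tree_iff\<close>).  The question thus is which trees occur in
  such shuffles, and the answer is: those with a vertex of fertility one.

  Shuffling always leaves such a vertex.  The recursion for two trees ends by shuffling a tree
  \<open>T'\<close> with the empty forest below a root \<open>a\<close>, and the result \<open>B_+^a(T')\<close> has a root of fertility
  one; later steps only put further vertices above it or further trees next to it
  (\<open>unary_shuffle\<close>).

  Conversely, a vertex of fertility one can be undone.  If \<open>T = B_+^a(T')\<close>, then \<open>T\<close> occurs in the
  shuffle of the one-vertex tree \<open>a\<close> with \<open>T'\<close>.  If the vertex lies in a subtree \<open>T\<^sub>1\<close> of
  \<open>T = B_+^a(T\<^sub>1 f)\<close> and \<open>T\<^sub>1\<close> occurs in the shuffle of \<open>S\<close> and \<open>t\<close>, then \<open>T\<close> occurs in the shuffle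
  of \<open>B_+^a(S f)\<close> and \<open>t\<close> (\<open>unary_imp_shuffle\<close>).  This relies on the fact that terms of the recursion do not
  cancel, as all coefficients are non-negative rational numbers (\<open>nonneg_shuffle\<close>).
\<close>

section \<open>Vectors with non-negative rational coordinates\<close>

text \<open>The scalars are an arbitrary, possibly unordered, field of characteristic zero, so positivity
  is expressed through the copy of the rational numbers that it contains.\<close>

definition nonneg :: "('b \<Rightarrow>\<^sub>0 'k::field_char_0) \<Rightarrow> bool" where
  "nonneg x \<longleftrightarrow> (\<forall>b. Poly_Mapping.lookup x b \<in> of_rat ` {0..})"

lemma nonneg_rat_closed:
  fixes c d :: "'k::field_char_0"
  shows "0 \<in> (of_rat ` {0..} :: 'k set)" "1 \<in> (of_rat ` {0..} :: 'k set)"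
    and "c \<in> of_rat ` {0..} \<Longrightarrow> d \<in> of_rat ` {0..} \<Longrightarrow> c + d \<in> of_rat ` {0..}"
    and "c \<in> of_rat ` {0..} \<Longrightarrow> d \<in> of_rat ` {0..} \<Longrightarrow> c * d \<in> of_rat ` {0..}"
    and "1 / of_nat n \<in> (of_rat ` {0..} :: 'k set)"
proof -
  show "0 \<in> (of_rat ` {0..} :: 'k set)" by (rule image_eqI[of _ _ 0]) simp_all
  show "1 \<in> (of_rat ` {0..} :: 'k set)" by (rule image_eqI[of _ _ 1]) simp_all
  show "1 / of_nat n \<in> (of_rat ` {0..} :: 'k set)"
    by (rule image_eqI[of _ _ "1 / of_nat n"]) (simp_all add: of_rat_divide)
  assume "c \<in> of_rat ` {0..}" "d \<in> of_rat ` {0..}"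
  then obtain p q where "p \<ge> 0" "c = of_rat p" "q \<ge> 0" "d = of_rat q" by auto
  then show "c + d \<in> of_rat ` {0..}" "c * d \<in> of_rat ` {0..}"
    by (simp_all flip: of_rat_add of_rat_mult)
qed

lemma lookup_smul: "Poly_Mapping.lookup (c \<cdot> x) b = c * Poly_Mapping.lookup x b"
  by (simp add: map.rep_eq when_def)

lemma nonneg_zero: "nonneg 0"
  by (simp add: nonneg_def nonneg_rat_closed)

lemma nonneg_basis: "nonneg (basis F)"
  by (simp add: nonneg_def lookup_single when_def nonneg_rat_closed)

lemma nonneg_add: "nonneg x \<Longrightarrow> nonneg y \<Longrightarrow> nonneg (x + y)"
  by (simp add: nonneg_def lookup_add nonneg_rat_closed)

lemma nonneg_smul: "c \<in> of_rat ` {0..} \<Longrightarrow> nonneg x \<Longrightarrow> nonneg (c \<cdot> x)"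
  by (simp add: nonneg_def lookup_smul nonneg_rat_closed)

lemma nonneg_sum: "(\<And>i. i \<in> I \<Longrightarrow> nonneg (x i)) \<Longrightarrow> nonneg (sum x I)"
  by (induction I rule: infinite_finite_induct) (auto intro: nonneg_zero nonneg_add)

lemma nonneg_sum_mset: "(\<And>i. i \<in># I \<Longrightarrow> nonneg (x i)) \<Longrightarrow> nonneg (\<Sum>i\<in>#I. x i)"
  by (induction I) (auto intro: nonneg_zero nonneg_add)

lemma nonneg_Bplus: "nonneg x \<Longrightarrow> nonneg (Bplus a x)"
  unfolding Bplus_def by (intro nonneg_sum nonneg_smul nonneg_basis) (simp add: nonneg_def)

lemma lookup_times_basis:
  fixes x :: "('o, 'k::field_char_0) fspace"
  shows "Poly_Mapping.lookup (x * basis G) K =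
    (if G \<subseteq># K then Poly_Mapping.lookup x (K - G) else 0)"
proof -
  have "Sum_any (\<lambda>q. Poly_Mapping.lookup (basis G :: ('o, 'k) fspace) q when K = l + q)
      = (1 when G \<subseteq># K \<and> l = K - G)" for l
  proof -
    have "(\<lambda>q. Poly_Mapping.lookup (basis G :: ('o, 'k) fspace) q when K = l + q)
        = (\<lambda>q. (1 when G \<subseteq># K \<and> l = K - G) when q = G)"
      by (auto simp: lookup_single when_def fun_eq_iff)
    then show ?thesis by (simp only: Sum_any_when_equal)
  qed
  then have "Poly_Mapping.lookup (x * basis G) K =
      Sum_any (\<lambda>l. (Poly_Mapping.lookup x l when G \<subseteq># K) when l = K - G)"
    unfolding lookup_mult by (intro arg_cong[of _ _ Sum_any]) (auto simp: when_def fun_eq_iff)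
  then show ?thesis by (simp only: Sum_any_when_equal) (simp add: when_def)
qed

lemma nonneg_times_basis:
  fixes x :: "('o, 'k::field_char_0) fspace"
  shows "nonneg x \<Longrightarrow> nonneg (x * basis G)"
  by (simp add: nonneg_def lookup_times_basis nonneg_rat_closed)

text \<open>Here positivity is used: without it, terms of a sum could cancel.\<close>

lemma keys_add_nonneg:
  assumes "nonneg x" "nonneg y"
  shows "Poly_Mapping.keys (x + y) = Poly_Mapping.keys x \<union> Poly_Mapping.keys y"
proof -
  have "Poly_Mapping.lookup x b + Poly_Mapping.lookup y b = 0 \<longleftrightarrow>
      Poly_Mapping.lookup x b = 0 \<and> Poly_Mapping.lookup y b = 0" for b
  proof -
    have "Poly_Mapping.lookup x b \<in> of_rat ` {0..}" "Poly_Mapping.lookup y b \<in> of_rat ` {0..}"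
      using assms by (simp_all add: nonneg_def)
    then obtain p q where "p \<ge> 0" "Poly_Mapping.lookup x b = of_rat p"
      and "q \<ge> 0" "Poly_Mapping.lookup y b = of_rat q"
      by auto
    then show ?thesis
      by (simp add: add_nonneg_eq_0_iff flip: of_rat_add)
  qed
  then show ?thesis unfolding set_eq_iff Un_iff in_keys_iff lookup_add by blast
qed

lemma keys_sum_mset_nonneg:
  assumes "\<And>i. i \<in># I \<Longrightarrow> nonneg (x i)"
  shows "Poly_Mapping.keys (\<Sum>i\<in>#I. x i) = (\<Union>i\<in>set_mset I. Poly_Mapping.keys (x i))"
  using assms
proof (induction I)
  case (add i I)
  then show ?case by (simp add: keys_add_nonneg nonneg_sum_mset)
qed simp

lemma keys_Bplus_eq: "Poly_Mapping.keys (Bplus a x) = (\<lambda>F. {#Node a F#}) ` Poly_Mapping.keys x"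
proof -
  have "Poly_Mapping.lookup (Bplus a x) {#Node a F#} = Poly_Mapping.lookup x F" for F
    by (simp add: Bplus_def lookup_sum lookup_smul lookup_single when_def in_keys_iff)
  then show ?thesis
    using keys_Bplus[of a x] by (auto simp: in_keys_iff)
qed

lemma keys_times_basis:
  fixes x :: "('o, 'k::field_char_0) fspace"
  shows "Poly_Mapping.keys (x * basis G) = (\<lambda>H. H + G) ` Poly_Mapping.keys x"
proof (intro set_eqI iffI)
  fix K assume "K \<in> Poly_Mapping.keys (x * basis G)"
  then have "G \<subseteq># K" "K - G \<in> Poly_Mapping.keys x"
    by (auto simp: in_keys_iff lookup_times_basis split: if_splits)
  then show "K \<in> (\<lambda>H. H + G) ` Poly_Mapping.keys x"
    by (intro image_eqI[of _ _ "K - G"]) simp_all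
qed (auto simp: in_keys_iff lookup_times_basis)

section \<open>The support of the shuffle product\<close>

lemma sh_forest_empty: "sh_forest {#} G = basis G" "sh_forest F {#} = basis F"
  by (subst sh_forest.simps, simp)+

lemma sh_forest_nonempty:
  assumes "F \<noteq> {#}" "G \<noteq> {#}"
  shows "sh_forest F G = (1 / of_nat (size F * size G)) \<cdot>
    (\<Sum>T\<in>#F. \<Sum>t\<in>#G. sh_tree T t * basis ((F - {#T#}) + (G - {#t#})))"
  by (subst sh_forest.simps) (simp only: assms if_False)

lemma nonneg_shuffle:
  "nonneg (sh_tree T t :: ('o, 'k::field_char_0) fspace)"
  "nonneg (sh_forest F G :: ('o, 'k) fspace)"
proof (induction T t and F G rule: sh_tree_sh_forest.induct)
  case (1 a f a' f')
  then show ?case by (simp add: sh_tree.simps nonneg_add nonneg_Bplus)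
next
  case (2 F F')
  show ?case
  proof (cases "F = {#} \<or> F' = {#}")
    case True
    then show ?thesis by (metis sh_forest_empty nonneg_basis)
  next
    case False
    then have ne: "F \<noteq> {#}" "F' \<noteq> {#}" by simp_all
    have "nonneg (sh_tree T t :: ('o, 'k) fspace)" if "T \<in># F" "t \<in># F'" for T t
      using "2.IH" ne that by blast
    then show ?thesis
      unfolding sh_forest_nonempty[OF ne]
      by (intro nonneg_smul nonneg_rat_closed nonneg_sum_mset nonneg_times_basis)
  qed
qed

text \<open>By positivity, the support of a shuffle obeys the same recursion as the shuffle itself, with
  unions in place of sums.  This reduces all questions about which forests occur in a shuffle to
  combinatorics.\<close>

lemma keys_sh_tree:
  "Poly_Mapping.keys (sh_tree (Node a f) (Node a' f') :: ('o, 'k::field_char_0) fspace) =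
     (\<lambda>H. {#Node a H#}) ` Poly_Mapping.keys (sh_forest f {#Node a' f'#} :: ('o, 'k) fspace) \<union>
     (\<lambda>H. {#Node a' H#}) ` Poly_Mapping.keys (sh_forest {#Node a f#} f' :: ('o, 'k) fspace)"
  by (simp add: sh_tree.simps keys_add_nonneg keys_Bplus_eq nonneg_Bplus nonneg_shuffle)

lemma keys_sh_forest:
  assumes "F \<noteq> {#}" "G \<noteq> {#}"
  shows "Poly_Mapping.keys (sh_forest F G :: ('o, 'k::field_char_0) fspace) =
    (\<Union>T\<in>set_mset F. \<Union>t\<in>set_mset G.
      (\<lambda>H. H + ((F - {#T#}) + (G - {#t#}))) `
        Poly_Mapping.keys (sh_tree T t :: ('o, 'k) fspace))"
proof -
  let ?S = "\<Sum>T\<in>#F. \<Sum>t\<in>#G. sh_tree T t * basis ((F - {#T#}) + (G - {#t#})) :: ('o, 'k) fspace"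
  have "sh_forest F G = (1 / of_nat (size F * size G)) \<cdot> ?S"
    using assms by (rule sh_forest_nonempty)
  moreover have "1 / of_nat (size F * size G) \<noteq> (0 :: 'k)"
    using assms by simp
  ultimately have "Poly_Mapping.keys (sh_forest F G :: ('o, 'k) fspace) = Poly_Mapping.keys ?S"
    by (simp add: set_eq_iff in_keys_iff lookup_smul del: of_nat_mult)
  then show ?thesis
    by (simp only: keys_sum_mset_nonneg nonneg_sum_mset nonneg_times_basis nonneg_shuffle
        keys_times_basis)
qed

section \<open>Vertices of fertility one\<close>

definition unary :: "'o forest \<Rightarrow> bool" where
  "unary F \<longleftrightarrow> (\<exists>T\<in>#F. \<exists>v\<in>#vertices T. fertility v = 1)"

lemma unary_add: "unary (F + G) \<longleftrightarrow> unary F \<or> unary G"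
  by (auto simp: unary_def)

lemma unary_Node: "unary {#Node a F#} \<longleftrightarrow> size F = 1 \<or> unary F"
  by (auto simp: unary_def)

text \<open>Grafting a forest on a new root and adding trees to it keep the vertices of fertility one,
  and the recursion starts with grafting a single tree.\<close>

lemma unary_shuffle:
  "H \<in> Poly_Mapping.keys (sh_tree T t :: ('o, 'k::field_char_0) fspace) \<Longrightarrow> unary H"
  "F \<noteq> {#} \<Longrightarrow> G \<noteq> {#} \<Longrightarrow> H \<in> Poly_Mapping.keys (sh_forest F G :: ('o, 'k) fspace) \<Longrightarrow> unary H"
proof (induction T t and F G arbitrary: H and H rule: sh_tree_sh_forest.induct)
  case (1 a f a' f')
  (* If the forest below one of the roots is empty, the induction hypothesis does not apply to it;
     then the other tree becomes the only child of that root. *)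
  then show ?case
    by (cases "f = {#}"; cases "f' = {#}") (auto simp: keys_sh_tree unary_Node sh_forest_empty)
next
  case (2 F F')
  then show ?case by (auto simp: keys_sh_forest unary_add)
qed

text \<open>Two trees suffice: a vertex of fertility one is cut off below, and all that stands above or
  beside it goes into the first factor.\<close>

lemma unary_imp_shuffle:
  fixes T :: "'o rtree"
  assumes "unary {#T#}"
  shows "\<exists>S t. {#T#} \<in> Poly_Mapping.keys (sh_tree S t :: ('o, 'k::field_char_0) fspace)"
  using assms
proof (induction T)
  case (Node a F)
  show ?case
  proof (cases "size F = 1")
    case True
    then obtain a' f' where "F = {#Node a' f'#}"
      by (metis size_1_singleton_mset rtree.exhaust)
    then have "{#Node a F#} \<in> Poly_Mapping.keys (sh_tree (Node a {#}) (Node a' f') :: ('o, 'k) fspace)"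
      by (simp add: keys_sh_tree sh_forest_empty)
    then show ?thesis by blast
  next
    case False
    with Node.prems obtain T1 where T1: "T1 \<in># F" "unary {#T1#}"
      unfolding unary_Node by (auto simp: unary_def)
    then obtain S t where St: "{#T1#} \<in> Poly_Mapping.keys (sh_tree S t :: ('o, 'k) fspace)"
      using Node.IH by blast
    (* In the shuffle of the forest S f with the tree t, the factor t may be matched with S. *)
    define f where "f = F - {#T1#}"
    have F: "F = add_mset T1 f" using T1 by (simp add: f_def)
    have "F \<in> Poly_Mapping.keys (sh_forest (add_mset S f) {#t#} :: ('o, 'k) fspace)"
      using St by (force simp: keys_sh_forest F)
    then have "{#Node a F#} \<in> Poly_Mapping.keys (sh_tree (Node a (add_mset S f)) t :: ('o, 'k) fspace)"
      by (cases t) (simp add: keys_sh_tree)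
    then show ?thesis by blast
  qed
qed

section \<open>Primitive trees\<close>

lemma lookup_dual_coproduct:
  fixes \<phi> :: "('o::finite, 'k::field_char_0) fdual"
  shows "Poly_Mapping.lookup (dual_coproduct \<phi>) (F, G) = pairing \<phi> (sh_forest F G)"
proof -
  have "basis F \<otimes> basis G = (basis (F, G) :: 'o forest \<times> 'o forest \<Rightarrow>\<^sub>0 'k)"
    by (simp add: tensor_def)
  then show ?thesis
    using dual_coproduct[of \<phi> "basis F" "basis G"] by (simp add: shuffle_basis pairing_def)
qed

lemma pairing_basis_left: "pairing (basis b) x = Poly_Mapping.lookup x b"
proof -
  have "pairing (basis b) x =
      (\<Sum>c\<in>Poly_Mapping.keys x. if b = c then Poly_Mapping.lookup x c else 0)"
    unfolding pairing_def by (intro sum.cong) (auto simp: lookup_single when_def)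
  then show ?thesis by (simp add: in_keys_iff)
qed

text \<open>The coordinates of the coproduct at pairs with an empty component are always those of a
  primitive element, as the empty forest is the unit of the shuffle product.\<close>

lemma dual_primitive_tree_iff:
  fixes T :: "'o::finite rtree"
  shows "dual_primitive (basis {#T#} :: ('o, 'k::field_char_0) fdual) \<longleftrightarrow>
    (\<forall>F G. F \<noteq> {#} \<longrightarrow> G \<noteq> {#} \<longrightarrow>
      {#T#} \<notin> Poly_Mapping.keys (sh_forest F G :: ('o, 'k) fspace))"
proof -
  let ?b = "basis {#T#} :: ('o, 'k) fdual"
  let ?P = "?b \<otimes> basis {#} + basis {#} \<otimes> ?b"
  have "Poly_Mapping.lookup (dual_coproduct ?b) (F, G) = Poly_Mapping.lookup ?P (F, G) \<longleftrightarrow>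
      (F \<noteq> {#} \<longrightarrow> G \<noteq> {#} \<longrightarrow> {#T#} \<notin> Poly_Mapping.keys (sh_forest F G :: ('o, 'k) fspace))" for F G
    by (cases "F = {#}"; cases "G = {#}")
      (auto simp: lookup_dual_coproduct pairing_basis_left lookup_add lookup_single when_def
        sh_forest_empty in_keys_iff simp del: single_one)
  then show ?thesis
    unfolding dual_primitive_def poly_mapping_eq_iff fun_eq_iff split_paired_All by blast
qed

theorem theorem2p14:
  fixes T :: "'o::finite rtree"
  shows "dual_primitive (basis {#T#} :: ('o, 'k::field_char_0) fdual) \<longleftrightarrow>
         (\<forall>v. v \<in># vertices T \<and> \<not> is_leaf v \<longrightarrow> fertility v \<ge> 2)"
proof -
  have "sh_forest {#S#} {#t#} = (sh_tree S t :: ('o, 'k) fspace)" for S t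
    by (subst sh_forest.simps) simp
  then have "dual_primitive (basis {#T#} :: ('o, 'k) fdual) \<longleftrightarrow> \<not> unary {#T#}"
    unfolding dual_primitive_tree_iff
    using unary_shuffle(2) unary_imp_shuffle[of T] by (metis add_mset_not_empty)
  also have "\<dots> \<longleftrightarrow> (\<forall>v. v \<in># vertices T \<and> \<not> is_leaf v \<longrightarrow> fertility v \<ge> 2)"
  proof -
    have "n \<noteq> 1 \<longleftrightarrow> (n \<noteq> 0 \<longrightarrow> n \<ge> 2)" for n :: nat by linarith
    then show ?thesis by (auto simp: unary_def is_leaf_def)
  qed
  finally show ?thesis .
qed

end
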